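(* Let $q$ be a prime power, $n$ a positive integer, and let $\alpha\in\mathbb{F}_{q^{2n}}$ be such that $\mathbb{F}_{q^{2n}}=\mathbb{F}_q(\alpha)$. Then the number $S(\alpha,2,n;q)$ of $2$-dimensional $\alpha$-splitting subspaces of $\mathbb{F}_{q^{2n}}$ is $$S(\alpha,2,n;q)=\frac{q^{2n}-1}{q^2-1}\,q^{2(n-1)}.$$
   Context: $\mathbb{F}_q$ denotes the finite field with $q$ elements. For positive integers $m,n$ and $\alpha\in\mathbb{F}_{q^{mn}}$, an $m$-dimensional $\mathbb{F}_q$-linear subspace $W$ of $\mathbb{F}_{q^{mn}}$ is called $\alpha$-splitting if $\mathbb{F}_{q^{mn}}=W\oplus \alpha W\oplus\cdots\oplus\alpha^{n-1}W$ (internal direct sum of $\mathbb{F}_q$-subspaces). $S(\alpha,m,n;q)$ denotes the number of $m$-dimensional $\alpha$-splitting subspaces of $\mathbb{F}_{q^{mn}}$. *)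

theory Defs
  imports "HOL-Algebra.Embedded_Algebras" "HOL-Algebra.Generated_Fields"
    "HOL-Number_Theory.Prime_Powers" Complex_Main
begin

definition linear_subspace :: "('a, 'b) ring_scheme \<Rightarrow> 'a set \<Rightarrow> 'a set \<Rightarrow> bool" where
  "linear_subspace R K W \<longleftrightarrow>
     subgroup W (add_monoid R) \<and> (\<forall>k\<in>K. \<forall>w\<in>W. k \<otimes>\<^bsub>R\<^esub> w \<in> W)"

text \<open>The ring \<open>R\<close> is the internal direct sum of the additive subgroups
  \<open>V 0, \<dots>, V (n - 1)\<close>; using \<open>\<Pi>\<^sub>E\<close> makes uniqueness of the tuple of summands literal.\<close>

definition internal_direct_sum :: "('a, 'b) ring_scheme \<Rightarrow> nat \<Rightarrow> (nat \<Rightarrow> 'a set) \<Rightarrow> bool" where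
  "internal_direct_sum R n V \<longleftrightarrow>
     (\<forall>i<n. subgroup (V i) (add_monoid R)) \<and>
     (\<forall>x\<in>carrier R. \<exists>!v. v \<in> (\<Pi>\<^sub>E i\<in>{..<n}. V i) \<and> x = (\<Oplus>\<^bsub>R\<^esub>i\<in>{..<n}. v i))"

definition splitting_subspaces ::
    "('a, 'b) ring_scheme \<Rightarrow> 'a set \<Rightarrow> 'a \<Rightarrow> nat \<Rightarrow> nat \<Rightarrow> 'a set set" where
  "splitting_subspaces R K \<alpha> m n =
     {W. linear_subspace R K W \<and> ring.dimension R m K W \<and>
         internal_direct_sum R n (\<lambda>i. (\<alpha> [^]\<^bsub>R\<^esub> i) <#\<^bsub>R\<^esub> W)}"

text \<open>The ambient field \<open>R\<close> and the base field \<open>K\<close> are explicit arguments; \<open>q\<close> is \<open>card K\<close>.\<close>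

definition num_splitting ::
    "('a, 'b) ring_scheme \<Rightarrow> 'a set \<Rightarrow> 'a \<Rightarrow> nat \<Rightarrow> nat \<Rightarrow> nat" where
  "num_splitting R K \<alpha> m n = card (splitting_subspaces R K \<alpha> m n)"

end

theory Submission
  imports Defs
begin

text \<open>
  Let \<open>V k\<close> be the span of \<open>1, \<alpha>, \<dots>, \<alpha>\<^bsup>k-1\<^esup>\<close>. A plane spanned by \<open>u\<close> and \<open>v\<close> is \<open>\<alpha>\<close>-splitting iff
  \<open>V n u + V n v\<close> is the whole field, that is, iff \<open>t = v/u\<close> is not a quotient \<open>x/y\<close> of elements of
  \<open>V n\<close>. Put \<open>N k t = {y \<in> V k. t y \<in> V k}\<close>. For \<open>m < n\<close>, whenever \<open>N (m + 1) t\<close> is nonzero it is exactly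
  one dimension larger than \<open>N m t\<close>: the leading coefficients of \<open>(y, t y)\<close> and \<open>(y', t y')\<close> are proportional
  since \<open>y (t y') = y' (t y)\<close> has degree below \<open>2n\<close>, and equality would make \<open>N m t\<close> stable under \<open>\<alpha>\<close>.
  As the nonzero elements of all \<open>N k t\<close> together number \<open>q\<^bsup>k\<^esup> (q\<^bsup>k\<^esup> - 1)\<close> (choose \<open>y\<close> and \<open>t y\<close>), comparing
  \<open>k = n\<close> with \<open>k = n - 1\<close> shows that there are \<open>q\<^bsup>2n-1\<^esup>\<close> such quotients. Counting ordered bases of
  splitting planes gives the result.
\<close>


section \<open>Linear subspaces\<close>

lemma linear_subspaceD:
  assumes "linear_subspace R K E"
  shows "E \<subseteq> carrier R" "\<zero>\<^bsub>R\<^esub> \<in> E"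
    "\<And>x y. x \<in> E \<Longrightarrow> y \<in> E \<Longrightarrow> x \<oplus>\<^bsub>R\<^esub> y \<in> E"
    "\<And>k x. k \<in> K \<Longrightarrow> x \<in> E \<Longrightarrow> k \<otimes>\<^bsub>R\<^esub> x \<in> E"
  using assms subgroup.subset subgroup.one_closed subgroup.m_closed
  unfolding linear_subspace_def by fastforce+

context ring
begin

lemma linear_subspace_a_inv:
  assumes "linear_subspace R K E" "x \<in> E"
  shows "\<ominus> x \<in> E"
  using assms add.subgroupE(3) unfolding linear_subspace_def by blast

lemma linear_subspace_minus:
  assumes "linear_subspace R K E" "x \<in> E" "y \<in> E"
  shows "x \<ominus> y \<in> E"
  using assms linear_subspaceD(3) linear_subspace_a_inv unfolding a_minus_def by metis

lemma linear_subspaceI: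
  assumes "E \<subseteq> carrier R" "\<zero> \<in> E" "\<And>x. x \<in> E \<Longrightarrow> \<ominus> x \<in> E"
    "\<And>x y. x \<in> E \<Longrightarrow> y \<in> E \<Longrightarrow> x \<oplus> y \<in> E"
    "\<And>k x. k \<in> K \<Longrightarrow> x \<in> E \<Longrightarrow> k \<otimes> x \<in> E"
  shows "linear_subspace R K E"
  unfolding linear_subspace_def
  using assms by (auto intro!: add.subgroupI)

lemma linear_subspace_zero:
  assumes "K \<subseteq> carrier R"
  shows "linear_subspace R K {\<zero>}"
  using assms by (intro linear_subspaceI) auto

lemma linear_subspace_line_extension:
  assumes "subfield K R" "linear_subspace R K E" "a \<in> carrier R"
  shows "linear_subspace R K (line_extension K a E)"
proof -
  have "k \<otimes> u \<in> line_extension K a E" if "k \<in> K" "u \<in> line_extension K a E" for k u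
    using line_extension_smult_closed[OF assms(1), of E a k u] linear_subspaceD[OF assms(2)] that
      assms(3) by blast
  then show ?thesis
    using line_extension_is_subgroup[OF assms(1) _ assms(3)] assms(2)
    unfolding linear_subspace_def by blast
qed

lemma line_extensionI:
  "k \<in> K \<Longrightarrow> v \<in> E \<Longrightarrow> k \<otimes> a \<oplus> v \<in> line_extension K a E"
  using line_extension_mem_iff by blast

lemma line_extension_incl:
  assumes "subfield K R" "linear_subspace R K E" "a \<in> carrier R"
  shows "E \<subseteq> line_extension K a E"
proof
  fix x assume "x \<in> E"
  then have "\<zero> \<otimes> a \<oplus> x \<in> line_extension K a E"
    using line_extensionI subringE(2)[OF subfieldE(1)[OF assms(1)]] by blast
  then show "x \<in> line_extension K a E"
    using \<open>x \<in> E\<close> linear_subspaceD(1)[OF assms(2)] assms(3) by auto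
qed

lemma line_extension_self:
  assumes "subfield K R" "linear_subspace R K E" "a \<in> carrier R"
  shows "a \<in> line_extension K a E"
proof -
  have "\<one> \<otimes> a \<oplus> \<zero> \<in> line_extension K a E"
    using line_extensionI subringE(3)[OF subfieldE(1)[OF assms(1)]] linear_subspaceD(2)[OF assms(2)]
    by blast
  then show ?thesis using assms(3) by simp
qed

lemma line_extension_subset:
  assumes "linear_subspace R K F" "E \<subseteq> F" "a \<in> F"
  shows "line_extension K a E \<subseteq> F"
  using assms linear_subspaceD[OF assms(1)] unfolding subset_iff line_extension_mem_iff by blast

end

text \<open>The map \<open>(k, v)\<close> to \<open>k a + v\<close> is injective on \<open>K\<close>
  times \<open>E\<close>: two representations with different coefficients would give a nonzero
  multiple of \<open>a\<close> in \<open>E\<close>, and dividing by that scalar would put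
  \<open>a\<close> itself in \<open>E\<close>. Dimensions are tracked through cardinalities by this
  lemma.\<close>

lemma (in field) card_line_extension:
  assumes K: "subfield K R" and E: "linear_subspace R K E" and a: "a \<in> carrier R" "a \<notin> E"
  shows "card (line_extension K a E) = card K * card E"
proof -
  note Ksub = subringE[OF subfieldE(1)[OF K]]
  have Ec: "E \<subseteq> carrier R" using linear_subspaceD(1)[OF E] .
  have "inj_on (\<lambda>(k, v). k \<otimes> a \<oplus> v) (K \<times> E)"
  proof (rule inj_onI, clarify)
    fix k v k' v'
    assume k: "k \<in> K" "k' \<in> K" and v: "v \<in> E" "v' \<in> E"
      and eq: "k \<otimes> a \<oplus> v = k' \<otimes> a \<oplus> v'"
    have c: "k \<in> carrier R" "k' \<in> carrier R" "v \<in> carrier R" "v' \<in> carrier R"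
      using k v Ksub(1) Ec by auto
    have e: "(k \<ominus> k') \<otimes> a = v' \<ominus> v"
    proof -
      have "(k \<ominus> k') \<otimes> a = (k \<otimes> a \<oplus> v) \<ominus> v \<ominus> k' \<otimes> a" using c a by algebra
      also have "\<dots> = v' \<ominus> v" unfolding eq using c a by algebra
      finally show ?thesis .
    qed
    have kk: "k \<ominus> k' \<in> K" using k Ksub(5,7) unfolding a_minus_def by blast
    have "k = k'"
    proof (rule ccontr)
      assume "k \<noteq> k'"
      then have nz: "k \<ominus> k' \<in> K - {\<zero>}" using kk c by simp
      note i = subfield_m_inv[OF K nz]
      have ic: "inv (k \<ominus> k') \<in> carrier R" using i(1) Ksub(1) by blast
      have "a = inv (k \<ominus> k') \<otimes> ((k \<ominus> k') \<otimes> a)"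
        using i(3) ic c a by (metis l_one m_assoc minus_closed)
      also have "\<dots> \<in> E"
        unfolding e using i(1) linear_subspaceD(4)[OF E] linear_subspace_minus[OF E v(2,1)] by blast
      finally show False using a by blast
    qed
    moreover from this have "v = v'" using eq c a by simp
    ultimately show "k = k' \<and> v = v'" by blast
  qed
  moreover have "(\<lambda>(k, v). k \<otimes> a \<oplus> v) ` (K \<times> E) = line_extension K a E"
    by (force simp: line_extension_mem_iff image_iff)
  ultimately show ?thesis
    using card_image[of "\<lambda>(k, v). k \<otimes> a \<oplus> v" "K \<times> E"] by (simp add: card_cartesian_product)
qed

text \<open>Multiplication by a nonzero \<open>k\<close> is injective on \<open>H\<close>, hence
  onto \<open>H\<close> by finiteness, so it takes the value 1.\<close>

lemma (in field) finite_subring_is_subfield: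
  assumes H: "subring H R" and fin: "finite H"
  shows "subfield H R"
proof -
  note Hsub = subringE[OF H]
  show ?thesis
  proof (rule subfieldI'[OF H])
    fix k assume k: "k \<in> H - {\<zero>}"
    have kc: "k \<in> carrier R" "k \<noteq> \<zero>" using k Hsub(1) by auto
    have "inj_on ((\<otimes>) k) H"
      using kc Hsub(1) by (auto intro!: inj_onI simp: m_lcancel subset_iff)
    moreover have "(\<otimes>) k ` H \<subseteq> H" using Hsub(6) k by auto
    ultimately have "(\<otimes>) k ` H = H" using fin endo_inj_surj by blast
    then obtain h where h: "h \<in> H" "k \<otimes> h = \<one>" using Hsub(3) by (metis imageE)
    then have "inv k = h" using kc Hsub(1) comm_inv_char by (simp add: subset_iff)
    then show "inv k \<in> H" using h by simp
  qed
qed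

section \<open>Multiplicative translates and internal direct sums\<close>

context field
begin

lemma linear_subspace_l_coset:
  assumes W: "linear_subspace R K W" and "K \<subseteq> carrier R" and a: "a \<in> carrier R"
  shows "linear_subspace R K (a <# W)"
proof -
  note Wc = linear_subspaceD(1)[OF W]
  have coset: "a <# W = (\<otimes>) a ` W" unfolding l_coset_def by auto
  show ?thesis unfolding coset
  proof (rule linear_subspaceI)
    show "(\<otimes>) a ` W \<subseteq> carrier R" using a Wc by auto
    show "\<zero> \<in> (\<otimes>) a ` W" using a linear_subspaceD(2)[OF W] by (intro image_eqI[of _ _ \<zero>]) auto
  next
    fix x assume "x \<in> (\<otimes>) a ` W"
    then obtain w where w: "w \<in> W" "x = a \<otimes> w" by blast
    then show "\<ominus> x \<in> (\<otimes>) a ` W"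
      using a Wc linear_subspace_a_inv[OF W w(1)] by (intro image_eqI[of _ _ "\<ominus> w"]) (auto simp: r_minus subset_iff)
  next
    fix x y assume "x \<in> (\<otimes>) a ` W" "y \<in> (\<otimes>) a ` W"
    then obtain v w where w: "v \<in> W" "w \<in> W" "x = a \<otimes> v" "y = a \<otimes> w" by blast
    then show "x \<oplus> y \<in> (\<otimes>) a ` W"
      using a Wc linear_subspaceD(3)[OF W w(1,2)] by (intro image_eqI[of _ _ "v \<oplus> w"]) (auto simp: r_distr subset_iff)
  next
    fix k x assume k: "k \<in> K" and "x \<in> (\<otimes>) a ` W"
    then obtain w where w: "w \<in> W" "x = a \<otimes> w" by blast
    then show "k \<otimes> x \<in> (\<otimes>) a ` W"
      using a k \<open>K \<subseteq> carrier R\<close> Wc linear_subspaceD(4)[OF W k w(1)]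
      by (intro image_eqI[of _ _ "k \<otimes> w"]) (auto simp: m_lcomm subset_iff)
  qed
qed

lemma card_l_coset_subset:
  assumes "W \<subseteq> carrier R" "a \<in> carrier R" "a \<noteq> \<zero>"
  shows "card (a <# W) = card W"
proof -
  have "a <# W = (\<otimes>) a ` W" unfolding l_coset_def by auto
  moreover have "inj_on ((\<otimes>) a) W"
    using assms by (auto intro!: inj_onI simp: m_lcancel subset_iff)
  ultimately show ?thesis by (simp add: card_image)
qed

text \<open>In the finite case the uniqueness of the summands follows from their existence by counting.\<close>

lemma internal_direct_sum_iff_surj:
  assumes "finite (carrier R)" and "\<And>i. i < n \<Longrightarrow> subgroup (U i) (add_monoid R)"
    and card: "(\<Prod>i<n. card (U i)) = card (carrier R)"
  shows "internal_direct_sum R n U \<longleftrightarrow>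
    carrier R \<subseteq> (\<lambda>w. \<Oplus>i\<in>{..<n}. w i) ` (\<Pi>\<^sub>E i\<in>{..<n}. U i)" (is "_ \<longleftrightarrow> _ \<subseteq> ?f ` ?P")
proof
  assume "internal_direct_sum R n U"
  then show "carrier R \<subseteq> ?f ` ?P"
    unfolding internal_direct_sum_def by blast
next
  assume surj: "carrier R \<subseteq> ?f ` ?P"
  have U: "U i \<subseteq> carrier R" if "i < n" for i
    using subgroup.subset[OF assms(2)[OF that]] by simp
  have sub: "?f ` ?P \<subseteq> carrier R"
  proof clarify
    fix w assume "w \<in> ?P"
    then have "w \<in> {..<n} \<rightarrow> carrier R" using U by (auto simp: PiE_def Pi_def)
    then show "?f w \<in> carrier R" by (rule finsum_closed)
  qed
  have "finite (U i)" if "i < n" for i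
    using U[OF that] assms(1) finite_subset by blast
  then have fin: "finite ?P" by (intro finite_PiE) auto
  have "card ?P = card (carrier R)" using card by (simp add: card_PiE)
  moreover have "?f ` ?P = carrier R" using surj sub by blast
  ultimately have "inj_on ?f ?P" using eq_card_imp_inj_on[OF fin, of ?f] by simp
  then have "\<forall>x\<in>carrier R. \<exists>!w. w \<in> ?P \<and> x = ?f w"
    using surj by (auto dest: inj_onD)
  moreover have "\<forall>i<n. subgroup (U i) (add_monoid R)" using assms(2) by simp
  ultimately show "internal_direct_sum R n U"
    unfolding internal_direct_sum_def by (intro conjI)
qed

end

section \<open>Iterated sums of subsets, and planes\<close>

context ring
begin

text \<open>Splitting off the last summand gives the recursion by which the sum of the translates of
  a plane is computed.\<close>

lemma sums_lessThan_Suc: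
  fixes U :: "nat \<Rightarrow> 'a set"
  assumes U: "\<And>i. U i \<subseteq> carrier R"
  shows "(\<lambda>w. \<Oplus>i\<in>{..<Suc k}. w i) ` (\<Pi>\<^sub>E i\<in>{..<Suc k}. U i)
    = {s \<oplus> z | s z. s \<in> (\<lambda>w. \<Oplus>i\<in>{..<k}. w i) ` (\<Pi>\<^sub>E i\<in>{..<k}. U i) \<and> z \<in> U k}"
    (is "?f ` ?P = ?Q")
proof (intro equalityI subsetI)
  fix s assume "s \<in> ?f ` ?P"
  then obtain w where w: "w \<in> ?P" "s = ?f w" by blast
  have wi: "w i \<in> U i" if "i \<le> k" for i using PiE_mem[OF w(1)] that by simp
  have wc: "w i \<in> carrier R" if "i \<le> k" for i using wi[OF that] U by blast
  \<comment> \<open>Functions in the smaller product are \<open>undefined\<close> outside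
    \<open>{..<k}\<close>, so the value at \<open>k\<close> has to be discarded.\<close>
  define w' where "w' = restrict w {..<k}"
  have 1: "w' \<in> (\<Pi>\<^sub>E i\<in>{..<k}. U i)" unfolding w'_def restrict_PiE_iff using wi by simp
  have "s = w k \<oplus> (\<Oplus>i\<in>{..<k}. w i)"
    unfolding w(2) lessThan_Suc using wc by (subst finsum_insert) auto
  also have "(\<Oplus>i\<in>{..<k}. w i) = (\<Oplus>i\<in>{..<k}. w' i)"
    unfolding w'_def using wc by (intro finsum_cong') auto
  also have "w k \<oplus> (\<Oplus>i\<in>{..<k}. w' i) = (\<Oplus>i\<in>{..<k}. w' i) \<oplus> w k"
    using wc unfolding w'_def by (intro a_comm finsum_closed) auto
  finally show "s \<in> ?Q" using 1 wi[of k] by blast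
next
  fix s assume "s \<in> ?Q"
  then obtain w z where w: "w \<in> (\<Pi>\<^sub>E i\<in>{..<k}. U i)" "z \<in> U k" "s = (\<Oplus>i\<in>{..<k}. w i) \<oplus> z"
    by blast
  have wc: "w i \<in> carrier R" if "i < k" for i using PiE_mem[OF w(1)] that U by blast
  have zc: "z \<in> carrier R" using w(2) U by blast
  define w' where "w' = w(k := z)"
  have 1: "w' \<in> ?P"
    unfolding w'_def lessThan_Suc using w(1,2) by (intro PiE_fun_upd)
  have "(\<Oplus>i\<in>{..<Suc k}. w' i) = w' k \<oplus> (\<Oplus>i\<in>{..<k}. w' i)"
    unfolding lessThan_Suc using wc zc by (subst finsum_insert) (auto simp: w'_def)
  also have "(\<Oplus>i\<in>{..<k}. w' i) = (\<Oplus>i\<in>{..<k}. w i)"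
    unfolding w'_def using wc by (intro finsum_cong') auto
  also have "w' k \<oplus> \<dots> = s"
    unfolding w(3) w'_def using wc zc by (simp add: a_comm)
  finally show "s \<in> ?f ` ?P" using 1 by blast
qed

text \<open>Adding one vector at a time mirrors the rules that generate \<open>dimension\<close>, so
  inverting them twice yields exactly this form. Independence of \<open>u\<close> and
  \<open>v\<close> is left to the lemmas that use it.\<close>

definition plane :: "'a set \<Rightarrow> 'a \<Rightarrow> 'a \<Rightarrow> 'a set" where
  "plane K u v = line_extension K v (line_extension K u {\<zero>})"

lemma dimension_two_iff:
  "dimension 2 K W \<longleftrightarrow> (\<exists>u v. u \<in> carrier R - {\<zero>} \<and> v \<in> carrier R - line_extension K u {\<zero>} \<and> W = plane K u v)"
proof
  assume "dimension 2 K W"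
  then have "dimension (Suc (Suc 0)) K W" by (simp add: numeral_2_eq_2)
  then obtain v E where v: "v \<in> carrier R" "v \<notin> E" "dimension (Suc 0) K E" "W = line_extension K v E"
    by (cases rule: dimension.cases) auto
  from v(3) obtain u F where u: "u \<in> carrier R" "u \<notin> F" "dimension 0 K F" "E = line_extension K u F"
    by (cases rule: dimension.cases) auto
  from u(3) have "F = {\<zero>}" by (cases rule: dimension.cases) auto
  with u show "\<exists>u v. u \<in> carrier R - {\<zero>} \<and> v \<in> carrier R - line_extension K u {\<zero>} \<and> W = plane K u v"
    using v unfolding plane_def by blast
next
  assume "\<exists>u v. u \<in> carrier R - {\<zero>} \<and> v \<in> carrier R - line_extension K u {\<zero>} \<and> W = plane K u v"
  then obtain u v where "u \<in> carrier R - {\<zero>}" "v \<in> carrier R - line_extension K u {\<zero>}" "W = plane K u v"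
    by blast
  then have "dimension (Suc (Suc 0)) K W"
    unfolding plane_def by (auto intro!: Suc_dim zero_dim)
  then show "dimension 2 K W" by (simp add: numeral_2_eq_2)
qed

end

section \<open>Simple extensions of finite fields\<close>

text \<open>The degree \<open>d\<close> stays arbitrary for the work on quotients and becomes
  \<open>2 * n\<close> only for splitting planes. Since infinite sets have \<open>card\<close> 0,
  \<open>card K > 1\<close> also encodes that \<open>K\<close> is finite.\<close>

locale finite_simple_extension = field +
  fixes K \<alpha> d
  assumes K: "subfield K R"
    and card_carrier: "card (carrier R) = card K ^ d"
    and card_K: "card K > 1"
    and \<alpha>: "\<alpha> \<in> carrier R"
    and gen: "generate_field R (insert \<alpha> K) = carrier R"
begin

text \<open>\<open>V k\<close> plays the role of the polynomials of degree less than \<open>k\<close>, evaluated at \<open>\<alpha>\<close>.\<close>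

primrec V :: "nat \<Rightarrow> 'a set" where
  "V 0 = {\<zero>}"
| "V (Suc k) = line_extension K (\<alpha> [^] k) (V k)"

lemmas Ksub = subringE[OF subfieldE(1)[OF K]]

lemma finite_carrier: "finite (carrier R)"
  using card_carrier card_K by (metis card.infinite not_gr_zero power_eq_0_iff not_less_zero)

lemma finite_K: "finite K"
  using Ksub(1) finite_carrier finite_subset by blast

lemma V_subspace: "linear_subspace R K (V k)"
  using \<alpha> Ksub(1)
  by (induction k) (simp_all add: linear_subspace_zero linear_subspace_line_extension[OF K])

lemmas V_carrier = linear_subspaceD(1)[OF V_subspace]
lemmas V_zero = linear_subspaceD(2)[OF V_subspace]
lemmas V_add = linear_subspaceD(3)[OF V_subspace]
lemmas V_smult = linear_subspaceD(4)[OF V_subspace]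
lemmas V_minus = linear_subspace_minus[OF V_subspace]

lemma V_carrierD: "x \<in> V k \<Longrightarrow> x \<in> carrier R"
  using V_carrier by blast

lemma finite_V: "finite (V k)"
  using V_carrier finite_carrier finite_subset by blast

lemma V_Suc_incl: "V k \<subseteq> V (Suc k)"
  using line_extension_incl[OF K V_subspace] \<alpha> by simp

lemma V_mono: "i \<le> j \<Longrightarrow> V i \<subseteq> V j"
  using lift_Suc_mono_le[of V] V_Suc_incl by blast

lemma power_mem_V: "\<alpha> [^] k \<in> V (Suc k)"
  using line_extension_self[OF K V_subspace] \<alpha> by simp

lemma V_SucE:
  assumes "x \<in> V (Suc k)"
  obtains a y where "a \<in> K" "y \<in> V k" "x = a \<otimes> \<alpha> [^] k \<oplus> y"
  using assms by (auto simp: line_extension_mem_iff)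

lemma generator_mult_V: "x \<in> V k \<Longrightarrow> \<alpha> \<otimes> x \<in> V (Suc k)"
proof (induction k arbitrary: x)
  case 0
  then show ?case using \<alpha> V_zero[of 1] by simp
next
  case (Suc k)
  obtain a y where ay: "a \<in> K" "y \<in> V k" "x = a \<otimes> \<alpha> [^] k \<oplus> y" using V_SucE[OF Suc.prems] .
  have c: "a \<in> carrier R" "y \<in> carrier R" "\<alpha> [^] k \<in> carrier R" using ay Ksub(1) V_carrier \<alpha> by auto
  have "\<alpha> \<otimes> x = a \<otimes> (\<alpha> [^] k \<otimes> \<alpha>) \<oplus> \<alpha> \<otimes> y"
    unfolding ay(3) using c \<alpha> by algebra
  then have "\<alpha> \<otimes> x = a \<otimes> \<alpha> [^] Suc k \<oplus> \<alpha> \<otimes> y"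
    by simp
  then show ?case using line_extensionI[OF ay(1) Suc.IH[OF ay(2)]] by simp
qed

lemma power_mult_V: "x \<in> V k \<Longrightarrow> \<alpha> [^] i \<otimes> x \<in> V (i + k)"
proof (induction i)
  case 0
  then show ?case using V_carrierD by simp
next
  case (Suc i)
  have "\<alpha> [^] Suc i \<otimes> x = \<alpha> \<otimes> (\<alpha> [^] i \<otimes> x)"
    using Suc.prems V_carrier \<alpha> by (simp add: m_ac subset_iff)
  then show ?case using generator_mult_V[OF Suc.IH[OF Suc.prems]] by simp
qed

text \<open>For positive \<open>i\<close> and \<open>j\<close> the degree bound could be lowered by
  one, but the weaker form suffices: it places a product of two elements of \<open>V m\<close> in
  \<open>V (2 * m)\<close>.\<close>

lemma V_mult: "x \<in> V i \<Longrightarrow> y \<in> V j \<Longrightarrow> x \<otimes> y \<in> V (i + j)"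
proof (induction i arbitrary: x)
  case 0
  then show ?case using V_zero V_carrierD by simp
next
  case (Suc i)
  obtain a z where az: "a \<in> K" "z \<in> V i" "x = a \<otimes> \<alpha> [^] i \<oplus> z" using V_SucE[OF Suc.prems(1)] .
  have c: "a \<in> carrier R" "z \<in> carrier R" "y \<in> carrier R" "\<alpha> [^] i \<in> carrier R"
    using az Suc.prems Ksub(1) V_carrier \<alpha> by auto
  have "x \<otimes> y = a \<otimes> (\<alpha> [^] i \<otimes> y) \<oplus> z \<otimes> y"
    unfolding az(3) using c by algebra
  moreover have "\<dots> \<in> V (i + j)"
    using V_add[OF V_smult[OF az(1) power_mult_V[OF Suc.prems(2)]] Suc.IH[OF az(2) Suc.prems(2)]] .
  ultimately show ?case using V_mono[of "i + j" "Suc i + j"] by auto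
qed

text \<open>There are \<open>card K ^ k\<close> coefficient vectors. Equality, for \<open>k\<close>
  up to \<open>d\<close>, has to wait for the independence of the powers of \<alpha>, whose proof
  uses this bound.\<close>

lemma card_V_le: "card (V k) \<le> card K ^ k"
proof (induction k)
  case (Suc k)
  have "V (Suc k) = (\<lambda>(a, y). a \<otimes> \<alpha> [^] k \<oplus> y) ` (K \<times> V k)"
    by (force simp: line_extension_mem_iff image_iff)
  then have "card (V (Suc k)) \<le> card (K \<times> V k)"
    using card_image_le[OF finite_cartesian_product[OF finite_K finite_V]] by simp
  also have "\<dots> \<le> card K * card K ^ k"
    unfolding card_cartesian_product using Suc by simp
  finally show ?case by simp
qed simp

text \<open>Stability under \<alpha> extends to all polynomials in \<alpha> over \<open>K\<close>.
  This is applied both to \<open>V k\<close> and to the spaces \<open>N m t\<close> below.\<close>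

lemma stable_subspace_mult:
  assumes E: "linear_subspace R K E" and stable: "\<And>x. x \<in> E \<Longrightarrow> \<alpha> \<otimes> x \<in> E"
    and "y \<in> E" "x \<in> V j"
  shows "x \<otimes> y \<in> E"
proof -
  have y: "y \<in> carrier R" using linear_subspaceD(1)[OF E] \<open>y \<in> E\<close> by blast
  have pow: "\<alpha> [^] i \<otimes> y \<in> E" for i :: nat
  proof (induction i)
    case 0
    then show ?case using y \<open>y \<in> E\<close> by simp
  next
    case (Suc i)
    have "\<alpha> [^] Suc i \<otimes> y = \<alpha> \<otimes> (\<alpha> [^] i \<otimes> y)"
      using y \<alpha> by (simp add: m_ac)
    then show ?case using stable Suc by simp
  qed
  show ?thesis using \<open>x \<in> V j\<close>
  proof (induction j arbitrary: x)
    case 0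
    then show ?case using linear_subspaceD(2)[OF E] y by simp
  next
    case (Suc j)
    obtain a z where az: "a \<in> K" "z \<in> V j" "x = a \<otimes> \<alpha> [^] j \<oplus> z" using V_SucE[OF Suc.prems] .
    have c: "a \<in> carrier R" "z \<in> carrier R" "\<alpha> [^] j \<in> carrier R"
      using az Ksub(1) V_carrier \<alpha> by auto
    have "x \<otimes> y = a \<otimes> (\<alpha> [^] j \<otimes> y) \<oplus> z \<otimes> y"
      unfolding az(3) using c y by algebra
    moreover have "\<dots> \<in> E"
      using linear_subspaceD(3)[OF E linear_subspaceD(4)[OF E az(1) pow] Suc.IH[OF az(2)]] .
    ultimately show ?case by simp
  qed
qed

text \<open>Stability makes \<open>V k\<close> closed under multiplication, hence a finite subring
  and so a subfield; it contains \<open>K\<close> and \<alpha>, which generate everything. The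
  condition \<open>k > 0\<close> puts 1 into \<open>V k\<close> and excludes the stable space
  \<open>V 0\<close>.\<close>

lemma stable_V_eq_carrier:
  assumes "\<And>x. x \<in> V k \<Longrightarrow> \<alpha> \<otimes> x \<in> V k" "k > 0"
  shows "V k = carrier R"
proof -
  have one: "\<one> \<in> V k"
    using power_mem_V[of 0] V_mono[of 1 k] assms(2) by auto
  have mult: "x \<otimes> y \<in> V k" if "x \<in> V k" "y \<in> V k" for x y
    using stable_subspace_mult[OF V_subspace assms(1)] that by blast
  have "subring (V k) R"
    using one mult V_carrier V_add linear_subspace_a_inv[OF V_subspace] by (intro subringI) auto
  then have sf: "subfield (V k) R"
    using finite_V finite_subring_is_subfield by blast
  have "K \<subseteq> V k"
  proof
    fix a assume "a \<in> K"
    then show "a \<in> V k" using V_smult[OF _ one, of a] Ksub(1) by auto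
  qed
  moreover have "\<alpha> \<in> V k" using assms(1)[OF one] \<alpha> by simp
  ultimately have "generate_field R (insert \<alpha> K) \<subseteq> V k"
    using generate_field_min_subfield1[OF _ sf, of "insert \<alpha> K"] \<alpha> Ksub(1) by blast
  then show ?thesis using gen V_carrier by blast
qed

text \<open>This says that \<alpha> satisfies no monic polynomial relation of degree below
  \<open>d\<close>. Such a relation of degree \<open>k\<close> would make \<open>V k\<close> stable
  under \<alpha>, hence the whole field, although it has at most \<open>card K ^ k\<close>
  elements.\<close>

lemma power_notin_V:
  assumes "k < d"
  shows "\<alpha> [^] k \<notin> V k"
proof
  assume mem: "\<alpha> [^] k \<in> V k"
  \<comment> \<open>The zeroth power is 1, which does not lie in \<open>V 0\<close>.\<close>
  have "k > 0" using mem by (cases k) auto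
  have "V (Suc k) \<subseteq> V k"
    using line_extension_subset[OF V_subspace _ mem] by simp
  then have "V k = carrier R"
    using stable_V_eq_carrier[OF _ \<open>k > 0\<close>] generator_mult_V by blast
  then have "card K ^ d \<le> card K ^ k" using card_V_le card_carrier by metis
  then show False using assms card_K by (simp add: power_increasing_iff)
qed

lemma card_V: "k \<le> d \<Longrightarrow> card (V k) = card K ^ k"
proof (induction k)
  case (Suc k)
  then show ?case
    using card_line_extension[OF K V_subspace _ power_notin_V] \<alpha> by simp
qed simp

lemma V_d: "V d = carrier R"
  using card_subset_eq[OF finite_carrier V_carrier] card_V[of d] card_carrier by simp

section \<open>Quotients of low-degree elements\<close>

text \<open>The nonzero elements are the denominators \<open>y\<close> in the representations of
  \<open>t\<close> as \<open>x/y\<close> with \<open>x\<close> and \<open>y\<close> in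
  \<open>V k\<close>. Together with 0 they form a subspace, which is what allows a dimension
  argument.\<close>

definition N :: "nat \<Rightarrow> 'a \<Rightarrow> 'a set" where
  "N k t = {y \<in> V k. t \<otimes> y \<in> V k}"

lemma N_subspace:
  assumes "t \<in> carrier R"
  shows "linear_subspace R K (N k t)"
proof (rule linear_subspaceI)
  show "N k t \<subseteq> carrier R" using V_carrier unfolding N_def by blast
  show "\<zero> \<in> N k t" using assms V_zero unfolding N_def by simp
next
  fix x assume "x \<in> N k t"
  then show "\<ominus> x \<in> N k t"
    using assms V_carrierD[of _ k] linear_subspace_a_inv[OF V_subspace] unfolding N_def
    by (simp add: r_minus)
next
  fix x y assume "x \<in> N k t" "y \<in> N k t"
  then show "x \<oplus> y \<in> N k t"
    using assms V_carrierD[of _ k] V_add unfolding N_def by (simp add: r_distr)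
next
  fix a x assume *: "a \<in> K" "x \<in> N k t"
  then have "t \<otimes> (a \<otimes> x) = a \<otimes> (t \<otimes> x)"
    using assms V_carrierD[of _ k] Ksub(1) unfolding N_def by (simp add: m_lcomm subset_iff)
  then show "a \<otimes> x \<in> N k t"
    using * V_smult unfolding N_def by simp
qed

lemma finite_N: "finite (N k t)"
  using finite_V unfolding N_def by simp

lemma N_Suc_incl: "N k t \<subseteq> N (Suc k) t"
  using V_Suc_incl unfolding N_def by blast

lemma generator_mult_N:
  assumes "t \<in> carrier R" "y \<in> N k t"
  shows "\<alpha> \<otimes> y \<in> N (Suc k) t"
proof -
  have "t \<otimes> (\<alpha> \<otimes> y) = \<alpha> \<otimes> (t \<otimes> y)"
    using assms(1) \<alpha> V_carrierD[of y k] assms(2) unfolding N_def by (simp add: m_lcomm)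
  then show ?thesis using assms generator_mult_V unfolding N_def by (simp del: V.simps)
qed

text \<open>Multiplication by \<alpha> maps \<open>N m t\<close> into \<open>N (Suc m) t\<close>, so
  equality makes \<open>N m t\<close> stable. A nonzero stable subspace is the whole field, which is
  too large to fit into \<open>V m\<close>.\<close>

lemma N_Suc_eq_imp_trivial:
  assumes t: "t \<in> carrier R" and m: "m < d" and eq: "N (Suc m) t = N m t"
  shows "N m t = {\<zero>}"
proof (rule ccontr)
  assume "N m t \<noteq> {\<zero>}"
  then obtain y where y: "y \<in> N m t" "y \<noteq> \<zero>"
    using linear_subspaceD(2)[OF N_subspace[OF t]] by blast
  have yc: "y \<in> carrier R" using y(1) V_carrierD unfolding N_def by blast
  have "x \<in> N m t" if x: "x \<in> carrier R" for x
  proof -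
    \<comment> \<open>Because \<open>V d\<close> is the whole field, the multiplier taking
      \<open>y\<close> to \<open>x\<close> is a polynomial in \<alpha>, to which stability
      applies.\<close>
    have "x \<otimes> inv y \<in> V d" unfolding V_d using x y yc by (simp add: field_Units)
    then have "(x \<otimes> inv y) \<otimes> y \<in> N m t"
      using stable_subspace_mult[OF N_subspace[OF t] _ y(1)] generator_mult_N[OF t] eq by blast
    then show ?thesis using x y yc by (simp add: m_assoc field_Units)
  qed
  then have "carrier R \<subseteq> V m" unfolding N_def by blast
  then have "card K ^ d \<le> card K ^ m"
    using card_mono[OF finite_V] card_V_le card_carrier le_trans by metis
  then show False using m card_K by simp
qed

text \<open>Subtracting the equal products leaves only one term outside \<open>V (2 * m)\<close>, a
  multiple of the power of \<alpha> with exponent \<open>2 * m\<close>. If its coefficient were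
  nonzero, that power would lie in \<open>V (2 * m)\<close>, contradicting
  \<open>power_notin_V\<close>.\<close>

lemma proportional_leading_coeffs:
  assumes "2 * m < d"
    and coeffs: "a \<in> K" "b \<in> K" "a' \<in> K" "b' \<in> K"
    and V: "x \<in> V m" "y \<in> V m" "x' \<in> V m" "y' \<in> V m"
    and eq: "(a \<otimes> \<alpha> [^] m \<oplus> x) \<otimes> (b' \<otimes> \<alpha> [^] m \<oplus> y') = (a' \<otimes> \<alpha> [^] m \<oplus> x') \<otimes> (b \<otimes> \<alpha> [^] m \<oplus> y)"
  shows "a \<otimes> b' = a' \<otimes> b"
proof (rule ccontr)
  assume ne: "a \<otimes> b' \<noteq> a' \<otimes> b"
  define p where "p = \<alpha> [^] m"
  have c: "a \<in> carrier R" "b \<in> carrier R" "a' \<in> carrier R" "b' \<in> carrier R"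
    "x \<in> carrier R" "y \<in> carrier R" "x' \<in> carrier R" "y' \<in> carrier R" "p \<in> carrier R"
    using coeffs V Ksub(1) V_carrierD \<alpha> unfolding p_def by auto
  \<comment> \<open>\<open>e\<close> is the coefficient of \<open>\<alpha>\<^bsup>2m\<^esup>\<close> in the difference of the two products, \<open>- r\<close> is the rest.\<close>
  define r where "r = (a' \<otimes> (p \<otimes> y) \<oplus> b \<otimes> (p \<otimes> x') \<oplus> x' \<otimes> y) \<ominus> (a \<otimes> (p \<otimes> y') \<oplus> b' \<otimes> (p \<otimes> x) \<oplus> x \<otimes> y')"
  define e where "e = a \<otimes> b' \<ominus> a' \<otimes> b"
  have "p \<otimes> z \<in> V (2 * m)" if "z \<in> V m" for z
    using power_mult_V[OF that, of m] unfolding p_def by (simp add: mult_2)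
  moreover have "z \<otimes> w \<in> V (2 * m)" if "z \<in> V m" "w \<in> V m" for z w
    using V_mult[OF that] by (simp add: mult_2)
  ultimately have rV: "r \<in> V (2 * m)"
    unfolding r_def using coeffs V by (simp add: V_minus V_add V_smult)
  have "e \<otimes> (p \<otimes> p) = (a \<otimes> p \<oplus> x) \<otimes> (b' \<otimes> p \<oplus> y') \<ominus> (a' \<otimes> p \<oplus> x') \<otimes> (b \<otimes> p \<oplus> y) \<oplus> r"
    unfolding r_def e_def using c by algebra
  also have "\<dots> = r"
    using eq c unfolding p_def[symmetric] r_def by (simp add: r_neg minus_eq)
  finally have er: "e \<otimes> (p \<otimes> p) = r" .
  have eK: "e \<in> K - {\<zero>}"
    using ne c coeffs Ksub(5,6,7) unfolding e_def by (simp add: a_minus_def[symmetric] r_right_minus_eq) (simp add: a_minus_def)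
  note i = subfield_m_inv[OF K eK]
  have ec: "e \<in> carrier R" "inv e \<in> carrier R" using i(1) eK Ksub(1) by auto
  have "p \<otimes> p = (inv e \<otimes> e) \<otimes> (p \<otimes> p)" using i(3) c by simp
  also have "\<dots> = inv e \<otimes> (e \<otimes> (p \<otimes> p))" using ec c by (simp only: m_assoc m_closed)
  also have "\<dots> \<in> V (2 * m)" unfolding er using i(1) rV V_smult by blast
  finally have "\<alpha> [^] (2 * m) \<in> V (2 * m)"
    unfolding p_def using \<alpha> by (simp add: nat_pow_mult mult_2)
  then show False using power_notin_V[OF assms(1)] by blast
qed

text \<open>The leading coefficients of \<open>(z, t z)\<close> are a common multiple
  \<open>c\<close> of those of \<open>(w, t w)\<close>. Hence \<open>z - c w\<close> loses both
  leading terms and falls into \<open>N m t\<close>.\<close>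

lemma N_Suc_eq_line_extension:
  assumes t: "t \<in> carrier R" and m: "2 * m < d" and w: "w \<in> N (Suc m) t" "w \<notin> N m t"
  shows "N (Suc m) t = line_extension K w (N m t)"
proof
  show "line_extension K w (N m t) \<subseteq> N (Suc m) t"
    using line_extension_subset[OF N_subspace[OF t] N_Suc_incl w(1)] .
  define p where "p = \<alpha> [^] m"
  have pc: "p \<in> carrier R" using \<alpha> unfolding p_def by simp
  obtain a x where ax: "a \<in> K" "x \<in> V m" "w = a \<otimes> p \<oplus> x"
    using w(1) V_SucE unfolding N_def p_def by blast
  obtain b y where bt: "b \<in> K" "y \<in> V m" "t \<otimes> w = b \<otimes> p \<oplus> y"
    using w(1) V_SucE unfolding N_def p_def by blast
  have wc: "w \<in> carrier R" using w(1) V_carrierD unfolding N_def by blast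
  \<comment> \<open>If both leading coefficients vanished, \<open>w\<close> would already lie in
    \<open>N m t\<close>. One of them can therefore serve as the divisor that defines
    \<open>c\<close>.\<close>
  have nz: "a \<noteq> \<zero> \<or> b \<noteq> \<zero>"
  proof (rule ccontr)
    assume "\<not> (a \<noteq> \<zero> \<or> b \<noteq> \<zero>)"
    then have "w = x" "t \<otimes> w = y" using ax bt pc V_carrierD[of _ m] by auto
    then show False using w(2) ax(2) bt(2) unfolding N_def by simp
  qed
  have ab: "a \<in> carrier R" "b \<in> carrier R" using ax bt Ksub(1) by auto
  show "N (Suc m) t \<subseteq> line_extension K w (N m t)"
  proof
    fix z assume z: "z \<in> N (Suc m) t"
    obtain a' x' where ax': "a' \<in> K" "x' \<in> V m" "z = a' \<otimes> p \<oplus> x'"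
      using z V_SucE unfolding N_def p_def by blast
    obtain b' y' where bt': "b' \<in> K" "y' \<in> V m" "t \<otimes> z = b' \<otimes> p \<oplus> y'"
      using z V_SucE unfolding N_def p_def by blast
    have zc: "z \<in> carrier R" using z V_carrierD unfolding N_def by blast
    have ab': "a' \<in> carrier R" "b' \<in> carrier R" using ax' bt' Ksub(1) by auto
    \<comment> \<open>Both sides equal \<open>t w z\<close>; this identity of products is the source
      of proportionality.\<close>
    have "w \<otimes> (t \<otimes> z) = z \<otimes> (t \<otimes> w)" using wc zc t by algebra
    then have "(a \<otimes> p \<oplus> x) \<otimes> (b' \<otimes> p \<oplus> y') = (a' \<otimes> p \<oplus> x') \<otimes> (b \<otimes> p \<oplus> y)"
      unfolding bt(3) bt'(3) ax(3)[symmetric] ax'(3)[symmetric] .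
    then have cross: "a \<otimes> b' = a' \<otimes> b"
      unfolding p_def
      using proportional_leading_coeffs[OF m ax(1) bt(1) ax'(1) bt'(1) ax(2) bt(2) ax'(2) bt'(2)]
      by blast
    obtain c where c: "c \<in> K" "a' = c \<otimes> a" "b' = c \<otimes> b"
    proof (cases "a = \<zero>")
      case False
      note i = subfield_m_inv[OF K, of a]
      have ic: "inv a \<in> carrier R" using False ab by (simp add: field_Units)
      have ii: "inv a \<otimes> a = \<one>" using False ab by (simp add: field_Units)
      have 1: "inv a \<otimes> a' \<in> K" using i ax ax' False Ksub(6) by auto
      have "a' = (inv a \<otimes> a) \<otimes> a'" using ii ab' by simp
      also have "\<dots> = (inv a \<otimes> a') \<otimes> a" using ic ab ab' by algebra
      finally have a': "a' = (inv a \<otimes> a') \<otimes> a" .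
      have "b' = (inv a \<otimes> a) \<otimes> b'" using ii ab' by simp
      also have "\<dots> = (inv a \<otimes> a') \<otimes> b" using ic ab ab' cross by (simp add: m_assoc)
      finally show ?thesis by (rule that[OF 1 a'])
    next
      case True
      then have b: "b \<noteq> \<zero>" using nz by blast
      note i = subfield_m_inv[OF K, of b]
      have ii: "inv b \<otimes> b = \<one>" "inv b \<in> carrier R" using b ab by (simp_all add: field_Units)
      have 1: "b' \<otimes> inv b \<in> K" using i bt bt' b Ksub(6) by auto
      have "a' \<otimes> b = \<zero>" using cross True ab' by simp
      then have "a' = \<zero>" using b ab ab' integral_iff by blast
      then have a': "a' = (b' \<otimes> inv b) \<otimes> a" using True ii ab' by simp
      show ?thesis by (rule that[OF 1 a']) (use ii ab ab' in \<open>simp add: m_assoc\<close>)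
    qed
    have cc: "c \<in> carrier R" using c Ksub(1) by blast
    have xc: "x \<in> carrier R" "y \<in> carrier R" "x' \<in> carrier R" "y' \<in> carrier R"
      using ax bt ax' bt' V_carrierD by auto
    have "z \<ominus> c \<otimes> w = x' \<ominus> c \<otimes> x"
      unfolding ax(3) ax'(3) c(2) using ab cc xc pc by algebra
    then have 1: "z \<ominus> c \<otimes> w \<in> V m" using V_minus[OF ax'(2) V_smult[OF c(1) ax(2)]] by simp
    have "t \<otimes> (z \<ominus> c \<otimes> w) = t \<otimes> z \<ominus> c \<otimes> (t \<otimes> w)" using t zc cc wc by algebra
    also have "\<dots> = y' \<ominus> c \<otimes> y"
      unfolding bt(3) bt'(3) c(3) using ab cc xc pc by algebra
    finally have 2: "t \<otimes> (z \<ominus> c \<otimes> w) \<in> V m" using V_minus[OF bt'(2) V_smult[OF c(1) bt(2)]] by simp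
    have "z \<ominus> c \<otimes> w \<in> N m t" using 1 2 unfolding N_def by simp
    note line_extensionI[OF c(1) this, of w]
    moreover have "c \<otimes> w \<oplus> (z \<ominus> c \<otimes> w) = z" using cc wc zc by algebra
    ultimately show "z \<in> line_extension K w (N m t)" by simp
  qed
qed

text \<open>If the two spaces coincided, both would be trivial by
  \<open>N_Suc_eq_imp_trivial\<close>. So some vector of the larger space lies outside the smaller
  one, and by the previous lemma it accounts for the whole difference.\<close>

lemma card_N_Suc:
  assumes t: "t \<in> carrier R" and m: "2 * m < d" and ne: "N (Suc m) t \<noteq> {\<zero>}"
  shows "card (N (Suc m) t) = card K * card (N m t)"
proof -
  have "N (Suc m) t \<noteq> N m t" using N_Suc_eq_imp_trivial[OF t, of m] m ne by auto
  then obtain w where w: "w \<in> N (Suc m) t" "w \<notin> N m t" using N_Suc_incl by blast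
  have "w \<in> carrier R" using w(1) V_carrierD unfolding N_def by blast
  then show ?thesis
    using N_Suc_eq_line_extension[OF t m w] card_line_extension[OF K N_subspace[OF t] _ w(2)] by simp
qed

text \<open>Double counting: a pair of a nonzero \<open>y\<close> and an arbitrary \<open>x\<close>
  in \<open>V k\<close> determines the unique \<open>t = x/y\<close> for which it is
  counted.\<close>

lemma sum_card_N:
  assumes "k \<le> d"
  shows "(\<Sum>t\<in>carrier R. card (N k t - {\<zero>})) = card K ^ k * (card K ^ k - 1)"
proof -
  have "bij_betw (\<lambda>(t, y). (y, t \<otimes> y)) (SIGMA t:carrier R. N k t - {\<zero>}) ((V k - {\<zero>}) \<times> V k)"
  proof (rule bij_betw_byWitness[where f' = "\<lambda>(y, x). (x \<otimes> inv y, y)"])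
    show "\<forall>p\<in>SIGMA t:carrier R. N k t - {\<zero>}. (\<lambda>(y, x). (x \<otimes> inv y, y)) ((\<lambda>(t, y). (y, t \<otimes> y)) p) = p"
      using V_carrierD[of _ k] by (auto simp: N_def m_assoc field_Units)
    show "\<forall>p\<in>(V k - {\<zero>}) \<times> V k. (\<lambda>(t, y). (y, t \<otimes> y)) ((\<lambda>(y, x). (x \<otimes> inv y, y)) p) = p"
      using V_carrierD[of _ k] by (auto simp: N_def m_assoc field_Units)
    show "(\<lambda>(t, y). (y, t \<otimes> y)) ` (SIGMA t:carrier R. N k t - {\<zero>}) \<subseteq> (V k - {\<zero>}) \<times> V k"
      by (auto simp: N_def)
    show "(\<lambda>(y, x). (x \<otimes> inv y, y)) ` ((V k - {\<zero>}) \<times> V k) \<subseteq> (SIGMA t:carrier R. N k t - {\<zero>})"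
      using V_carrierD[of _ k] by (auto simp: N_def m_assoc field_Units)
  qed
  then have "card (SIGMA t:carrier R. N k t - {\<zero>}) = card ((V k - {\<zero>}) \<times> V k)"
    by (rule bij_betw_same_card)
  then show ?thesis
    using finite_carrier finite_N V_zero finite_V card_V[OF assms]
    by (simp add: card_cartesian_product card_Diff_singleton mult.commute)
qed

text \<open>The total for \<open>Suc m\<close> minus \<open>q\<close> times the total for
  \<open>m\<close> receives \<open>q - 1\<close> from each \<open>t\<close> with nontrivial
  \<open>N (Suc m) t\<close> and nothing from the others. Both totals are known from
  \<open>sum_card_N\<close>.\<close>

lemma card_nontrivial_N:
  assumes m: "2 * m < d"
  shows "card {t \<in> carrier R. N (Suc m) t \<noteq> {\<zero>}} = card K ^ (2 * m + 1)"
proof -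
  define S where "S = {t \<in> carrier R. N (Suc m) t \<noteq> {\<zero>}}"
  \<comment> \<open>The comparison involves differences, so it is carried out in the
    integers.\<close>
  define q where "q = int (card K)"
  have q: "q > 1" using card_K unfolding q_def by simp
  have z: "\<zero> \<in> N k t" if "t \<in> carrier R" for k t
    using linear_subspaceD(2)[OF N_subspace[OF that]] .
  have ci: "int (card (N k t - {\<zero>})) = int (card (N k t)) - 1" if "t \<in> carrier R" for k t
  proof -
    have "card (N k t) > 0" using z[OF that] finite_N card_gt_0_iff by blast
    then show ?thesis using z[OF that] finite_N by (simp add: card_Diff_singleton)
  qed
  \<comment> \<open>Removing 0 from both spaces turns the factor \<open>q\<close> into
    \<open>q c - 1 = q (c - 1) + (q - 1)\<close>, where \<open>c\<close> is the size of
    \<open>N m t\<close>.\<close>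
  have step: "int (card (N (Suc m) t - {\<zero>})) = q * int (card (N m t - {\<zero>})) + (q - 1) * (if t \<in> S then 1 else 0)"
    if t: "t \<in> carrier R" for t
  proof (cases "t \<in> S")
    case True
    then have "int (card (N (Suc m) t)) = q * int (card (N m t))"
      using card_N_Suc[OF t m] unfolding S_def q_def by simp
    then show ?thesis using True by (simp add: ci[OF t] algebra_simps)
  next
    case False
    then have "N (Suc m) t = {\<zero>}" "N m t = {\<zero>}"
      using t N_Suc_incl[of m t] z[OF t, of m] unfolding S_def by auto
    then show ?thesis using False by simp
  qed
  have sum: "(\<Sum>t\<in>carrier R. int (card (N k t - {\<zero>}))) = q ^ k * (q ^ k - 1)" if "k \<le> d" for k
  proof -
    have "card K ^ k \<ge> 1" using card_K by simp
    then show ?thesis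
      using arg_cong[OF sum_card_N[OF that], of int] unfolding q_def by (simp add: of_nat_diff)
  qed
  have "q ^ Suc m * (q ^ Suc m - 1) = (\<Sum>t\<in>carrier R. int (card (N (Suc m) t - {\<zero>})))"
    using sum[of "Suc m"] m by simp
  also have "\<dots> = (\<Sum>t\<in>carrier R. q * int (card (N m t - {\<zero>})) + (q - 1) * (if t \<in> S then 1 else 0))"
    by (rule sum.cong) (auto simp: step)
  also have "\<dots> = q * (q ^ m * (q ^ m - 1)) + (q - 1) * (\<Sum>t\<in>carrier R. if t \<in> S then 1 else 0)"
    using sum[of m] m by (simp add: sum.distrib sum_distrib_left[symmetric])
  also have "(\<Sum>t\<in>carrier R. if t \<in> S then 1 else 0 :: int) = int (card S)"
  proof -
    have "carrier R \<inter> S = S" unfolding S_def by blast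
    then show ?thesis using finite_carrier by (simp add: sum.If_cases)
  qed
  \<comment> \<open>In the difference of the two totals the terms \<open>q ^ (m + 1)\<close> cancel,
    leaving \<open>q ^ (2 * m + 2) - q ^ (2 * m + 1)\<close>.\<close>
  finally have "(q - 1) * int (card S) = (q - 1) * q ^ (2 * m + 1)"
    by (simp add: algebra_simps power_mult power2_eq_square power_mult_distrib)
  then have "int (card S) = q ^ (2 * m + 1)" using q by simp
  then have "card S = card K ^ (2 * m + 1)" unfolding q_def by (metis of_nat_eq_iff of_nat_power)
  then show ?thesis unfolding S_def .
qed

section \<open>Splitting planes\<close>

lemma line_subspace: "u \<in> carrier R \<Longrightarrow> linear_subspace R K (line_extension K u {\<zero>})"
  using linear_subspace_line_extension[OF K linear_subspace_zero[OF Ksub(1)]] .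

lemma card_line: "u \<in> carrier R - {\<zero>} \<Longrightarrow> card (line_extension K u {\<zero>}) = card K"
  using card_line_extension[OF K linear_subspace_zero[OF Ksub(1)]] by simp

lemma plane_subspace: "u \<in> carrier R \<Longrightarrow> v \<in> carrier R \<Longrightarrow> linear_subspace R K (plane K u v)"
  unfolding plane_def using linear_subspace_line_extension[OF K line_subspace] .

lemma card_plane:
  "u \<in> carrier R - {\<zero>} \<Longrightarrow> v \<in> carrier R - line_extension K u {\<zero>} \<Longrightarrow> card (plane K u v) = card K ^ 2"
  unfolding plane_def using card_line_extension[OF K line_subspace] card_line
  by (simp add: power2_eq_square)

lemma plane_mem_iff:
  assumes "u \<in> carrier R"
  shows "w \<in> plane K u v \<longleftrightarrow> (\<exists>a\<in>K. \<exists>b\<in>K. w = b \<otimes> v \<oplus> a \<otimes> u)"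
proof -
  have "a \<otimes> u \<oplus> \<zero> = a \<otimes> u" if "a \<in> K" for a using that assms Ksub(1) by auto
  then have line: "line_extension K u {\<zero>} = (\<lambda>a. a \<otimes> u) ` K"
    by (auto simp: line_extension_mem_iff)
  show ?thesis
    unfolding plane_def line line_extension_mem_iff by blast
qed

lemma plane_subset:
  assumes "linear_subspace R K W" "u \<in> W" "v \<in> W"
  shows "plane K u v \<subseteq> W"
  unfolding plane_def
  using assms linear_subspaceD(2)[OF assms(1)] by (intro line_extension_subset[OF assms(1)]) auto

lemma plane_gens:
  assumes "u \<in> carrier R" "v \<in> carrier R"
  shows "u \<in> plane K u v" "v \<in> plane K u v"
  unfolding plane_def
  using line_extension_self[OF K line_subspace] line_extension_incl[OF K line_subspace]
    line_extension_self[OF K linear_subspace_zero[OF Ksub(1)]] assms by blast+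

text \<open>In a sum of terms \<alpha>^i (a_i u + b_i v), the coefficients of \<open>u\<close> and
  of \<open>v\<close> collect into two independent polynomials in \<alpha> of degree below
  \<open>k\<close>.\<close>

lemma sums_translates_plane:
  assumes u: "u \<in> carrier R" and v: "v \<in> carrier R"
  shows "(\<lambda>w. \<Oplus>i\<in>{..<k}. w i) ` (\<Pi>\<^sub>E i\<in>{..<k}. (\<alpha> [^] i) <# plane K u v)
    = (\<lambda>(x, y). x \<otimes> u \<oplus> y \<otimes> v) ` (V k \<times> V k)"
proof (induction k)
  case 0
  then show ?case using u v by simp
next
  case (Suc k)
  define p where "p = \<alpha> [^] k"
  have pc: "p \<in> carrier R" unfolding p_def using \<alpha> by simp
  have comb: "x \<otimes> u \<oplus> y \<otimes> v \<in> (\<lambda>(x, y). x \<otimes> u \<oplus> y \<otimes> v) ` (V j \<times> V j)"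
    if "x \<in> V j" "y \<in> V j" for x y j
    using that by (intro image_eqI[of _ _ "(x, y)"]) simp_all
  define U where "U i = (\<alpha> [^] i) <# plane K u v" for i :: nat
  have U: "U i \<subseteq> carrier R" for i
    unfolding U_def
    using linear_subspaceD(1)[OF linear_subspace_l_coset[OF plane_subspace[OF u v] Ksub(1)]] \<alpha> by simp
  have "(\<lambda>w. \<Oplus>i\<in>{..<Suc k}. w i) ` (\<Pi>\<^sub>E i\<in>{..<Suc k}. U i)
    = {s \<oplus> z | s z. s \<in> (\<lambda>w. \<Oplus>i\<in>{..<k}. w i) ` (\<Pi>\<^sub>E i\<in>{..<k}. U i) \<and> z \<in> U k}"
    by (rule sums_lessThan_Suc[OF U])
  also have "\<dots> = {s \<oplus> z | s z. s \<in> (\<lambda>(x, y). x \<otimes> u \<oplus> y \<otimes> v) ` (V k \<times> V k) \<and> z \<in> U k}"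
    unfolding Suc.IH[folded U_def] ..
  also have "\<dots> = (\<lambda>(x, y). x \<otimes> u \<oplus> y \<otimes> v) ` (V (Suc k) \<times> V (Suc k))"
  proof (intro equalityI subsetI)
    fix s assume "s \<in> {s \<oplus> z | s z. s \<in> (\<lambda>(x, y). x \<otimes> u \<oplus> y \<otimes> v) ` (V k \<times> V k) \<and> z \<in> U k}"
    then obtain x y z where xyz: "x \<in> V k" "y \<in> V k" "z \<in> U k" "s = (x \<otimes> u \<oplus> y \<otimes> v) \<oplus> z" by auto
    from xyz(3) obtain w where w: "w \<in> plane K u v" "z = p \<otimes> w" unfolding U_def l_coset_def p_def by blast
    then obtain a b where ab: "a \<in> K" "b \<in> K" "w = b \<otimes> v \<oplus> a \<otimes> u" unfolding plane_mem_iff[OF u] by blast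
    have c: "a \<in> carrier R" "b \<in> carrier R" "x \<in> carrier R" "y \<in> carrier R"
      using ab xyz Ksub(1) V_carrierD by auto
    have "s = (a \<otimes> p \<oplus> x) \<otimes> u \<oplus> (b \<otimes> p \<oplus> y) \<otimes> v"
      unfolding xyz(4) w(2) ab(3) using c u v pc by algebra
    moreover have "a \<otimes> p \<oplus> x \<in> V (Suc k)" "b \<otimes> p \<oplus> y \<in> V (Suc k)"
      using ab xyz line_extensionI unfolding p_def by auto
    ultimately show "s \<in> (\<lambda>(x, y). x \<otimes> u \<oplus> y \<otimes> v) ` (V (Suc k) \<times> V (Suc k))"
      using comb[of "a \<otimes> p \<oplus> x" "Suc k" "b \<otimes> p \<oplus> y"] by (simp del: V.simps)
  next
    fix s assume "s \<in> (\<lambda>(x, y). x \<otimes> u \<oplus> y \<otimes> v) ` (V (Suc k) \<times> V (Suc k))"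
    then obtain x' y' where s: "x' \<in> V (Suc k)" "y' \<in> V (Suc k)" "s = x' \<otimes> u \<oplus> y' \<otimes> v" by (auto simp del: V.simps)
    obtain a x where ax: "a \<in> K" "x \<in> V k" "x' = a \<otimes> p \<oplus> x" using V_SucE[OF s(1)] unfolding p_def .
    obtain b y where bt: "b \<in> K" "y \<in> V k" "y' = b \<otimes> p \<oplus> y" using V_SucE[OF s(2)] unfolding p_def .
    have c: "a \<in> carrier R" "b \<in> carrier R" "x \<in> carrier R" "y \<in> carrier R"
      using ax bt Ksub(1) V_carrierD by auto
    have eq: "s = (x \<otimes> u \<oplus> y \<otimes> v) \<oplus> p \<otimes> (b \<otimes> v \<oplus> a \<otimes> u)"
      unfolding s(3) ax(3) bt(3) using c u v pc by algebra
    have "b \<otimes> v \<oplus> a \<otimes> u \<in> plane K u v" using ax bt plane_mem_iff[OF u] by blast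
    then have "p \<otimes> (b \<otimes> v \<oplus> a \<otimes> u) \<in> U k" unfolding U_def l_coset_def p_def by blast
    moreover have "x \<otimes> u \<oplus> y \<otimes> v \<in> (\<lambda>(x, y). x \<otimes> u \<oplus> y \<otimes> v) ` (V k \<times> V k)"
      using comb[OF ax(2) bt(2)] .
    ultimately show "s \<in> {s \<oplus> z | s z. s \<in> (\<lambda>(x, y). x \<otimes> u \<oplus> y \<otimes> v) ` (V k \<times> V k) \<and> z \<in> U k}"
      using eq by blast
  qed
  finally show ?case unfolding U_def .
qed

text \<open>Since \<open>d = 2 * n\<close>, source and target have equally many elements, so
  surjectivity is injectivity. With \<open>t = v/u\<close>, the kernel consists of the pairs
  \<open>(- t y, y)\<close> with \<open>y\<close> in \<open>N n t\<close>.\<close>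

lemma carrier_eq_combinations_iff:
  assumes d: "d = 2 * n" and u: "u \<in> carrier R - {\<zero>}" and v: "v \<in> carrier R"
  shows "carrier R \<subseteq> (\<lambda>(x, y). x \<otimes> u \<oplus> y \<otimes> v) ` (V n \<times> V n) \<longleftrightarrow> N n (v \<otimes> inv u) = {\<zero>}"
    (is "_ \<subseteq> ?f ` _ \<longleftrightarrow> _")
proof -
  have uc: "u \<in> carrier R" "inv u \<in> carrier R" "u \<otimes> inv u = \<one>" "inv u \<otimes> u = \<one>"
    using u by (auto simp: field_Units)
  define t where "t = v \<otimes> inv u"
  have tc: "t \<in> carrier R" unfolding t_def using uc v by simp
  have tu: "v = t \<otimes> u" unfolding t_def using uc v by (simp add: m_assoc)
  have card: "card (V n \<times> V n) = card (carrier R)"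
    unfolding card_cartesian_product card_carrier using card_V[of n] d by (simp add: mult_2 power_add)
  have sub: "?f ` (V n \<times> V n) \<subseteq> carrier R" using uc v V_carrierD[of _ n] by auto
  have fin: "finite (V n \<times> V n)" using finite_V by blast
  have "carrier R \<subseteq> ?f ` (V n \<times> V n) \<longleftrightarrow> inj_on ?f (V n \<times> V n)"
  proof
    assume "carrier R \<subseteq> ?f ` (V n \<times> V n)"
    then have "?f ` (V n \<times> V n) = carrier R" using sub by blast
    then show "inj_on ?f (V n \<times> V n)"
      using eq_card_imp_inj_on[OF fin, of ?f] card by simp
  next
    assume "inj_on ?f (V n \<times> V n)"
    then have "card (?f ` (V n \<times> V n)) = card (carrier R)" using card by (simp add: card_image)
    then show "carrier R \<subseteq> ?f ` (V n \<times> V n)" using card_subset_eq[OF finite_carrier sub] by simp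
  qed
  also have "\<dots> \<longleftrightarrow> N n t = {\<zero>}"
  proof
    assume inj: "inj_on ?f (V n \<times> V n)"
    have "y = \<zero>" if y: "y \<in> N n t" for y
    proof -
      have yV: "y \<in> V n" "t \<otimes> y \<in> V n" using y unfolding N_def by auto
      have yc: "y \<in> carrier R" using yV V_carrierD by blast
      have m: "\<ominus> (t \<otimes> y) \<in> V n" using linear_subspace_a_inv[OF V_subspace yV(2)] .
      have "?f (\<ominus> (t \<otimes> y), y) = ?f (\<zero>, \<zero>)"
        unfolding tu using uc tc yc by (simp, algebra)
      then show ?thesis using inj_onD[OF inj, of "(\<ominus> (t \<otimes> y), y)" "(\<zero>, \<zero>)"] m yV V_zero by simp
    qed
    then show "N n t = {\<zero>}" using linear_subspaceD(2)[OF N_subspace[OF tc]] by blast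
  next
    assume N: "N n t = {\<zero>}"
    show "inj_on ?f (V n \<times> V n)"
    proof (rule inj_onI, clarify)
      fix x y x' y'
      assume V: "x \<in> V n" "y \<in> V n" "x' \<in> V n" "y' \<in> V n" and eq: "x \<otimes> u \<oplus> y \<otimes> v = x' \<otimes> u \<oplus> y' \<otimes> v"
      have c: "x \<in> carrier R" "y \<in> carrier R" "x' \<in> carrier R" "y' \<in> carrier R"
        using V V_carrierD by auto
      have "(t \<otimes> (y \<ominus> y')) \<otimes> u = (x \<otimes> u \<oplus> y \<otimes> v) \<ominus> (x \<otimes> u \<oplus> y' \<otimes> v)"
        unfolding tu using c tc uc(1) by algebra
      also have "\<dots> = (x' \<ominus> x) \<otimes> u"
        unfolding eq using c v uc(1) by algebra
      finally have "t \<otimes> (y \<ominus> y') = x' \<ominus> x"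
        using u c tc m_rcancel by simp
      then have "y \<ominus> y' \<in> N n t"
        unfolding N_def using V_minus V by simp
      then have yy: "y = y'" using N c by simp
      moreover have "x = x'"
        using eq c u v unfolding yy by (simp add: m_rcancel)
      ultimately show "x = x' \<and> y = y'" by blast
    qed
  qed
  finally show ?thesis unfolding t_def .
qed

lemma direct_sum_plane_iff:
  assumes d: "d = 2 * n" "n > 0" and u: "u \<in> carrier R - {\<zero>}"
    and v: "v \<in> carrier R - line_extension K u {\<zero>}"
  shows "internal_direct_sum R n (\<lambda>i. (\<alpha> [^] i) <# plane K u v) \<longleftrightarrow> N n (v \<otimes> inv u) = {\<zero>}"
proof -
  have uv: "u \<in> carrier R" "v \<in> carrier R" using u v by auto
  \<comment> \<open>Here \<open>1 < d\<close> because \<open>d = 2 * n\<close> with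
    \<open>n > 0\<close>, so \<alpha> lies outside \<open>V 1\<close>, which contains 0.\<close>
  have "\<alpha> \<noteq> \<zero>"
    using power_notin_V[of 1] V_zero[of 1] d \<alpha> by auto
  then have nz: "\<alpha> [^] i \<noteq> \<zero>" for i :: nat
    using \<alpha> by (induction i) (auto simp: integral_iff)
  \<comment> \<open>Each translate by a nonzero power keeps the \<open>card K ^ 2\<close> elements
    of the plane. This supplies the cardinality condition under which a direct sum reduces to
    surjectivity.\<close>
  have "(\<Prod>i<n. card ((\<alpha> [^] i) <# plane K u v)) = card (carrier R)"
    unfolding card_l_coset_subset[OF linear_subspaceD(1)[OF plane_subspace[OF uv]] nat_pow_closed[OF \<alpha>] nz]
      card_plane[OF u v] card_carrier d by (simp add: power_mult)
  moreover have "subgroup ((\<alpha> [^] i) <# plane K u v) (add_monoid R)" for i :: nat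
    using linear_subspace_l_coset[OF plane_subspace[OF uv] Ksub(1)] \<alpha>
    unfolding linear_subspace_def by simp
  ultimately show ?thesis
    using internal_direct_sum_iff_surj[OF finite_carrier, of n "\<lambda>i. (\<alpha> [^] i) <# plane K u v"]
      sums_translates_plane[OF uv, of n] carrier_eq_combinations_iff[OF d(1) u uv(2)] by simp
qed

text \<open>Inclusion and equal cardinality suffice. The lemma recovers \<open>W\<close> from any of
  its ordered bases.\<close>

lemma plane_eqI:
  assumes W: "linear_subspace R K W" "card W = card K ^ 2"
    and u: "u \<in> W - {\<zero>}" and v: "v \<in> W - line_extension K u {\<zero>}"
  shows "plane K u v = W"
proof (rule card_subset_eq)
  show "finite W" using linear_subspaceD(1)[OF W(1)] finite_carrier finite_subset by blast
  show "plane K u v \<subseteq> W" using plane_subset[OF W(1)] u v by blast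
  show "card (plane K u v) = card W"
    using card_plane[of u v] u v linear_subspaceD(1)[OF W(1)] W(2) by auto
qed

text \<open>Scalars preserve \<open>V n\<close>. Consequently a trivial \<open>N n (v/u)\<close>
  already forces \<open>u\<close> and \<open>v\<close> to be linearly independent.\<close>

lemma N_base_field_nontrivial:
  assumes "a \<in> K" "n > 0" "n \<le> d"
  shows "N n a \<noteq> {\<zero>}"
proof -
  have "N n a = V n" unfolding N_def using V_smult assms by blast
  moreover have "card (V n) > 1" using card_V[OF assms(3)] one_less_power[OF card_K assms(2)] by simp
  ultimately show ?thesis by auto
qed

text \<open>Both sides describe the ordered bases of splitting planes: the left through the ratio
  \<open>v/u\<close>, which makes them countable, the right grouped by the plane they span.\<close>

lemma splitting_pairs_eq:
  assumes d: "d = 2 * n" "n > 0"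
  shows "(SIGMA u:carrier R - {\<zero>}. {v \<in> carrier R. N n (v \<otimes> inv u) = {\<zero>}})
    = (\<Union>W\<in>splitting_subspaces R K \<alpha> 2 n. SIGMA u:W - {\<zero>}. W - line_extension K u {\<zero>})"
    (is "?P = ?Q")
proof (intro equalityI subsetI)
  fix p assume "p \<in> ?P"
  then obtain u v where p: "p = (u, v)" and u: "u \<in> carrier R - {\<zero>}" and v: "v \<in> carrier R"
    and N: "N n (v \<otimes> inv u) = {\<zero>}" by blast
  have ui: "inv u \<in> carrier R" "u \<otimes> inv u = \<one>" using u by (auto simp: field_Units)
  have v': "v \<in> carrier R - line_extension K u {\<zero>}"
  proof -
    have False if "v \<in> line_extension K u {\<zero>}"
    proof -
      from that obtain a where a: "a \<in> K" "v = a \<otimes> u \<oplus> \<zero>" unfolding line_extension_mem_iff by blast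
      have "v \<otimes> inv u = a" using a u ui Ksub(1) by (auto simp: m_assoc subset_iff)
      then show False using N N_base_field_nontrivial[OF a(1) d(2)] d by simp
    qed
    then show ?thesis using v by blast
  qed
  have "dimension 2 K (plane K u v)" unfolding dimension_two_iff using u v' by blast
  then have "plane K u v \<in> splitting_subspaces R K \<alpha> 2 n"
    unfolding splitting_subspaces_def
    using plane_subspace[of u v] u v direct_sum_plane_iff[OF d u v'] N by simp
  moreover have "u \<in> plane K u v - {\<zero>}" "v \<in> plane K u v - line_extension K u {\<zero>}"
    using plane_gens[of u v] u v' by auto
  ultimately show "p \<in> ?Q" unfolding p by blast
next
  fix p assume "p \<in> ?Q"
  then obtain W u v where p: "p = (u, v)" and W: "W \<in> splitting_subspaces R K \<alpha> 2 n"
    and u: "u \<in> W - {\<zero>}" and v: "v \<in> W - line_extension K u {\<zero>}" by blast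
  have sub: "linear_subspace R K W" and "dimension 2 K W"
    and sum: "internal_direct_sum R n (\<lambda>i. (\<alpha> [^] i) <# W)"
    using W unfolding splitting_subspaces_def by auto
  then have card: "card W = card K ^ 2" using card_plane unfolding dimension_two_iff by blast
  have uv: "u \<in> carrier R - {\<zero>}" "v \<in> carrier R - line_extension K u {\<zero>}"
    using u v linear_subspaceD(1)[OF sub] by auto
  have "N n (v \<otimes> inv u) = {\<zero>}"
    using direct_sum_plane_iff[OF d uv] sum unfolding plane_eqI[OF sub card u v] by blast
  then show "p \<in> ?P" unfolding p using uv by blast
qed

text \<open>Ordered bases are counted twice: plane by plane, and by choosing \<open>u\<close> and
  then the ratio \<open>v/u\<close>. The product form avoids division of natural numbers.\<close>

lemma card_splitting_subspaces:
  assumes d: "d = 2 * n" "n > 0"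
  shows "card (splitting_subspaces R K \<alpha> 2 n) * ((card K ^ 2 - 1) * (card K ^ 2 - card K))
    = (card K ^ (2 * n) - 1) * (card K ^ (2 * n) - card K ^ (2 * n - 1))"
proof -
  let ?q = "card K" and ?S = "splitting_subspaces R K \<alpha> 2 n"
  let ?I = "\<lambda>W. SIGMA u:W - {\<zero>}. W - line_extension K u {\<zero>}"
  have sub: "linear_subspace R K W" and cardW: "card W = ?q ^ 2" and finW: "finite W"
    if W: "W \<in> ?S" for W
  proof -
    show 1: "linear_subspace R K W" using W unfolding splitting_subspaces_def by blast
    show "card W = ?q ^ 2"
      using W card_plane unfolding splitting_subspaces_def dimension_two_iff by blast
    show "finite W" using linear_subspaceD(1)[OF 1] finite_carrier finite_subset by blast
  qed
  have finS: "finite ?S"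
    using finite_subset[of ?S "Pow (carrier R)"] finite_carrier linear_subspaceD(1)[OF sub] by blast
  have cardI: "card (?I W) = (?q ^ 2 - 1) * (?q ^ 2 - ?q)" if W: "W \<in> ?S" for W
  proof -
    have "card (W - line_extension K u {\<zero>}) = ?q ^ 2 - ?q" if u: "u \<in> W - {\<zero>}" for u
    proof -
      have "line_extension K u {\<zero>} \<subseteq> W"
        using line_extension_subset[OF sub[OF W]] linear_subspaceD(2)[OF sub[OF W]] u by simp
      moreover have "card (line_extension K u {\<zero>}) = ?q"
        using card_line u linear_subspaceD(1)[OF sub[OF W]] by blast
      ultimately show ?thesis
        using card_Diff_subset[of "line_extension K u {\<zero>}" W] finW[OF W] cardW[OF W]
          finite_subset by metis
    qed
    moreover have "card (W - {\<zero>}) = ?q ^ 2 - 1"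
      using finW[OF W] cardW[OF W] linear_subspaceD(2)[OF sub[OF W]] by (simp add: card_Diff_singleton)
    ultimately show ?thesis using finW[OF W] by (subst card_SigmaI) auto
  qed
  \<comment> \<open>An ordered basis determines its plane, so no pair is counted for two different
    planes.\<close>
  have disj: "?I W \<inter> ?I W' = {}" if W: "W \<in> ?S" "W' \<in> ?S" "W \<noteq> W'" for W W'
  proof -
    have False if "(u, v) \<in> ?I W" "(u, v) \<in> ?I W'" for u v
    proof -
      have "plane K u v = W" using plane_eqI[OF sub[OF W(1)] cardW[OF W(1)]] that(1) by blast
      moreover have "plane K u v = W'" using plane_eqI[OF sub[OF W(2)] cardW[OF W(2)]] that(2) by blast
      ultimately show False using W(3) by blast
    qed
    then show ?thesis by blast
  qed
  have "card (\<Union>W\<in>?S. ?I W) = (\<Sum>W\<in>?S. card (?I W))"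
    using finS finW disj by (intro card_UN_disjoint) auto
  also have "\<dots> = card ?S * ((?q ^ 2 - 1) * (?q ^ 2 - ?q))"
    using cardI by simp
  finally have lhs: "card (\<Union>W\<in>?S. ?I W) = card ?S * ((?q ^ 2 - 1) * (?q ^ 2 - ?q))" .
  define T where "T = {t \<in> carrier R. N n t = {\<zero>}}"
  obtain m where m: "n = Suc m" using d(2) gr0_implies_Suc by blast
  \<comment> \<open>Taking complements, \<open>card_nontrivial_N\<close> is used at
    \<open>m = n - 1\<close>, where its exponent \<open>2 * m + 1\<close> is
    \<open>2 * n - 1\<close>.\<close>
  have cardT: "card T = ?q ^ (2 * n) - ?q ^ (2 * n - 1)"
  proof -
    have "T = carrier R - {t \<in> carrier R. N n t \<noteq> {\<zero>}}" unfolding T_def by blast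
    then have "card T = card (carrier R) - card {t \<in> carrier R. N n t \<noteq> {\<zero>}}"
      using finite_carrier by (simp add: card_Diff_subset)
    then show ?thesis using card_nontrivial_N[of m] m d card_carrier by simp
  qed
  \<comment> \<open>For fixed nonzero \<open>u\<close>, division by \<open>u\<close> is a bijection
    onto \<open>T\<close>, so the number of admissible \<open>v\<close> does not depend on
    \<open>u\<close>.\<close>
  have "card {v \<in> carrier R. N n (v \<otimes> inv u) = {\<zero>}} = card T" if u: "u \<in> carrier R - {\<zero>}" for u
  proof (rule bij_betw_same_card)
    have ui: "inv u \<in> carrier R" "u \<otimes> inv u = \<one>" "inv u \<otimes> u = \<one>" "u \<in> carrier R"
      using u by (auto simp: field_Units)
    have cancel: "x \<otimes> inv u \<otimes> u = x" "x \<otimes> u \<otimes> inv u = x" if "x \<in> carrier R" for x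
      using that ui by (simp_all add: m_assoc)
    show "bij_betw (\<lambda>v. v \<otimes> inv u) {v \<in> carrier R. N n (v \<otimes> inv u) = {\<zero>}} T"
    proof (rule bij_betwI[where g = "\<lambda>t. t \<otimes> u"])
      show "(\<lambda>v. v \<otimes> inv u) \<in> {v \<in> carrier R. N n (v \<otimes> inv u) = {\<zero>}} \<rightarrow> T"
        unfolding T_def using ui(1) by simp
      show "(\<lambda>t. t \<otimes> u) \<in> T \<rightarrow> {v \<in> carrier R. N n (v \<otimes> inv u) = {\<zero>}}"
        unfolding T_def using ui(4) cancel(2) by simp
    qed (simp_all add: cancel T_def)
  qed
  then have "card (SIGMA u:carrier R - {\<zero>}. {v \<in> carrier R. N n (v \<otimes> inv u) = {\<zero>}})
      = card (carrier R - {\<zero>}) * card T"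
    using finite_carrier by (subst card_SigmaI) auto
  also have "\<dots> = (?q ^ (2 * n) - 1) * (?q ^ (2 * n) - ?q ^ (2 * n - 1))"
    using cardT card_carrier d(1) finite_carrier by (simp add: card_Diff_singleton)
  finally show ?thesis using lhs splitting_pairs_eq[OF d] by simp
qed

end

theorem theorem3p4:
  fixes L :: "('a, 'b) ring_scheme" and K :: "'a set" and \<alpha> :: 'a and q n :: nat
  assumes "primepow q" and "n > 0"
    and "field L" and "card (carrier L) = q ^ (2 * n)"
    and "subfield K L" and "card K = q"
    and "\<alpha> \<in> carrier L" and "generate_field L (insert \<alpha> K) = carrier L"
  shows "real (num_splitting L K \<alpha> 2 n) =
    (real q ^ (2 * n) - 1) / (real q ^ 2 - 1) * real q ^ (2 * (n - 1))"
proof -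
  have q: "q > 1" using assms(1) primepow_gt_Suc_0 by simp
  interpret finite_simple_extension L K \<alpha> "2 * n"
    using assms q by (intro finite_simple_extension.intro finite_simple_extension_axioms.intro) simp_all
  obtain m where m: "n = Suc m" using assms(2) gr0_implies_Suc by blast
  let ?s = "real (num_splitting L K \<alpha> 2 n)" and ?q = "real q"
  have "num_splitting L K \<alpha> 2 n * ((q ^ 2 - 1) * (q ^ 2 - q))
      = (q ^ (2 * n) - 1) * (q ^ (2 * n) - q ^ (2 * n - 1))"
    using card_splitting_subspaces[OF refl assms(2)] unfolding num_splitting_def assms(6) .
  then have "real (num_splitting L K \<alpha> 2 n * ((q ^ 2 - 1) * (q ^ 2 - q)))
      = real ((q ^ (2 * n) - 1) * (q ^ (2 * n) - q ^ (2 * n - 1)))"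
    by simp
  \<comment> \<open>These inequalities ensure that no natural-number subtraction is truncated when
    passing to the reals.\<close>
  moreover have "1 \<le> q ^ 2" "q \<le> q ^ 2" "1 \<le> q ^ (2 * n)" "q ^ (2 * n - 1) \<le> q ^ (2 * n)"
    using q by (auto simp: power2_eq_square intro: power_increasing)
  ultimately have "?s * ((?q ^ 2 - 1) * (?q ^ 2 - ?q))
      = (?q ^ (2 * n) - 1) * (?q ^ (2 * n) - ?q ^ (2 * n - 1))"
    by (simp only: of_nat_mult of_nat_diff of_nat_power of_nat_1)
  \<comment> \<open>The factor \<open>?q ^ 2 - ?q\<close> is extracted from
    \<open>?q ^ (2 * n) - ?q ^ (2 * n - 1)\<close>, so that it can be cancelled against the number
    of choices for the second basis vector.\<close>
  also have "\<dots> = (?q ^ (2 * n) - 1) * ?q ^ (2 * (n - 1)) * (?q ^ 2 - ?q)"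
    unfolding m by (simp add: algebra_simps power2_eq_square)
  finally have eq: "(?s * (?q ^ 2 - 1)) * (?q ^ 2 - ?q)
      = ((?q ^ (2 * n) - 1) * ?q ^ (2 * (n - 1))) * (?q ^ 2 - ?q)"
    by (simp only: mult.assoc)
  have "?q ^ 2 - ?q \<noteq> 0" using q by (simp add: power2_eq_square)
  then have "?s * (?q ^ 2 - 1) = (?q ^ (2 * n) - 1) * ?q ^ (2 * (n - 1))"
    using mult_right_cancel[THEN iffD1, OF _ eq] by blast
  moreover have "?q ^ 2 - 1 \<noteq> 0"
  proof -
    have "1 < ?q" using q by simp
    then have "1 < ?q ^ 2" by (rule one_less_power) simp
    then show ?thesis by simp
  qed
  ultimately show ?thesis by (simp only: times_divide_eq_left eq_divide_eq not_False_eq_True if_True)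
qed

end
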